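(* Every downset $D$ in a polyhedral partially ordered group $Q$ is the union $\bigcup_\tau \Gamma_\tau(D_\tau)$ of its local $\tau$-supports for all faces $\tau$ of the positive cone.
   Context: A partially ordered group is an abelian group $Q$ generated by a submonoid $Q_+$ (the positive cone) with trivial unit group, ordered by $q\preceq q'\iff q'-q\in Q_+$. A face of $Q_+$ is a submonoid $\sigma\subseteq Q_+$ such that $Q_+\smallsetminus\sigma$ is an ideal of the monoid $Q_+$. $Q$ is polyhedral if it has only finitely many faces. A downset is a subset closed under going down. For a downset $D\subseteq Q$ and a face $\tau$: the localization of $D$ along $\tau$ is $D_\tau=\{q\in D\mid q+\tau\subseteq D\}$ (again a downset). An element $q\in D$ is globally supported on $\tau$ if $q\notin D_{\tau'}$ for every face $\tau'\not\subseteq\tau$; $\Gamma_\tau D$ is the set of $q\in D$ globally supported on $\tau$. The local $\tau$-support of $D$ is $\Gamma_\tau(D_\tau)\subseteq D$, the set of elements globally supported on $\tau$ in the downset $D_\tau$. *)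

theory Defs
  imports Main "HOL-Computational_Algebra.Group_Closure"
begin

text \<open>
  The ambient group \<open>Q\<close> is a type of class \<open>ab_group_add\<close>; its positive cone \<open>Q\<^sub>+\<close> is an
  explicit subset \<open>P\<close>.
\<close>

definition add_submonoid :: "'a::ab_group_add set \<Rightarrow> bool" where
  "add_submonoid M \<longleftrightarrow> 0 \<in> M \<and> (\<forall>x\<in>M. \<forall>y\<in>M. x + y \<in> M)"

definition positive_cone :: "'a::ab_group_add set \<Rightarrow> bool" where
  "positive_cone P \<longleftrightarrow>
     add_submonoid P \<and> {p \<in> P. - p \<in> P} = {0} \<and> group_closure P = UNIV"

definition cone_le :: "'a::ab_group_add set \<Rightarrow> 'a \<Rightarrow> 'a \<Rightarrow> bool" where
  "cone_le P q q' \<longleftrightarrow> q' - q \<in> P"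

text \<open>Ideals of a monoid may be empty, so that \<open>P\<close> is a face of itself.\<close>

definition monoid_ideal :: "'a::ab_group_add set \<Rightarrow> 'a set \<Rightarrow> bool" where
  "monoid_ideal P I \<longleftrightarrow> I \<subseteq> P \<and> (\<forall>p\<in>P. \<forall>x\<in>I. p + x \<in> I)"

definition face :: "'a::ab_group_add set \<Rightarrow> 'a set \<Rightarrow> bool" where
  "face P \<sigma> \<longleftrightarrow> add_submonoid \<sigma> \<and> \<sigma> \<subseteq> P \<and> monoid_ideal P (P - \<sigma>)"

definition polyhedral_pogroup :: "'a::ab_group_add set \<Rightarrow> bool" where
  "polyhedral_pogroup P \<longleftrightarrow> positive_cone P \<and> finite {\<sigma>. face P \<sigma>}"

definition downset :: "'a::ab_group_add set \<Rightarrow> 'a set \<Rightarrow> bool" where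
  "downset P D \<longleftrightarrow> (\<forall>q\<in>D. \<forall>q'. cone_le P q' q \<longrightarrow> q' \<in> D)"

definition localization :: "'a::ab_group_add set \<Rightarrow> 'a set \<Rightarrow> 'a set" where
  "localization \<tau> D = {q \<in> D. (\<lambda>t. q + t) ` \<tau> \<subseteq> D}"

definition globally_supported ::
    "'a::ab_group_add set \<Rightarrow> 'a set \<Rightarrow> 'a set \<Rightarrow> 'a \<Rightarrow> bool" where
  "globally_supported P \<tau> D q \<longleftrightarrow>
     (\<forall>\<tau>'. face P \<tau>' \<and> \<not> \<tau>' \<subseteq> \<tau> \<longrightarrow> q \<notin> localization \<tau>' D)"

definition global_support :: "'a::ab_group_add set \<Rightarrow> 'a set \<Rightarrow> 'a set \<Rightarrow> 'a set" where
  "global_support P \<tau> D = {q \<in> D. globally_supported P \<tau> D q}"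

definition local_support :: "'a::ab_group_add set \<Rightarrow> 'a set \<Rightarrow> 'a set \<Rightarrow> 'a set" where
  "local_support P \<tau> D = global_support P \<tau> (localization \<tau> D)"

end

theory Submission
  imports Defs
begin

text \<open>
  For \<open>q \<in> D\<close>, pick a face \<open>\<tau>\<close> that is maximal among those with \<open>q + \<tau> \<subseteq> D\<close>; the face \<open>{0}\<close>
  is one of them, and there are finitely many faces. Then \<open>q\<close> lies in the local \<open>\<tau>\<close>-support.
  Indeed, if \<open>q\<close> remained in the localization of \<open>D\<^sub>\<tau>\<close> along another face \<open>\<tau>'\<close>, then
  \<open>q + \<tau> + \<tau>' \<subseteq> D\<close>. Every element of the face generated by \<open>\<tau> + \<tau>'\<close> is dominated by an element
  of \<open>\<tau> + \<tau>'\<close>, so, \<open>D\<close> being a downset, the translate by \<open>q\<close> of that whole face lies in \<open>D\<close>.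
  By maximality the face is \<open>\<tau>\<close> itself, whence \<open>\<tau>' \<subseteq> \<tau>\<close>. The two ingredients are the
  description of the generated face (\<open>face_face_hull\<close>) and the passage from a submonoid to it
  (\<open>localization_face_hull\<close>).
\<close>

text \<open>
  The smallest face containing a submonoid \<open>M\<close> is the set of elements of the cone lying below
  some element of \<open>M\<close>.
\<close>
definition face_hull :: "'a::ab_group_add set \<Rightarrow> 'a set \<Rightarrow> 'a set" where
  "face_hull P M = {p \<in> P. \<exists>r\<in>P. p + r \<in> M}"

lemma face_face_hull:
  assumes P: "add_submonoid P" and M: "add_submonoid M"
  shows "face P (face_hull P M)"
proof -
  have "0 \<in> face_hull P M"
    using P M by (auto simp: face_hull_def add_submonoid_def)
  moreover have "x + y \<in> face_hull P M"
    if x: "x \<in> face_hull P M" and y: "y \<in> face_hull P M" for x y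
  proof -
    from x y obtain r s where rs: "r \<in> P" "s \<in> P" "x + r \<in> M" "y + s \<in> M" "x \<in> P" "y \<in> P"
      by (auto simp: face_hull_def)
    have "(x + r) + (y + s) \<in> M" and "r + s \<in> P" and "x + y \<in> P"
      using rs P M by (auto simp: add_submonoid_def)
    moreover have "(x + r) + (y + s) = (x + y) + (r + s)"
      by (simp add: algebra_simps)
    ultimately show ?thesis
      by (auto simp: face_hull_def)
  qed
  ultimately have "add_submonoid (face_hull P M)"
    by (simp add: add_submonoid_def)
  \<comment> \<open>A summand of an element below \<open>M\<close> is itself below \<open>M\<close>: the other summand joins the witness.\<close>
  moreover have "p + x \<notin> face_hull P M" if "p \<in> P" "x \<in> P" "x \<notin> face_hull P M" for p x
  proof
    assume "p + x \<in> face_hull P M"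
    then obtain r where r: "r \<in> P" "x + (p + r) \<in> M"
      by (auto simp: face_hull_def ac_simps)
    moreover have "p + r \<in> P"
      using r that(1) P by (simp add: add_submonoid_def)
    ultimately show False
      using that(2,3) by (auto simp: face_hull_def)
  qed
  ultimately show ?thesis
    using P by (auto simp: face_def monoid_ideal_def add_submonoid_def face_hull_def)
qed

lemma subset_face_hull:
  assumes "0 \<in> P" and "M \<subseteq> P"
  shows "M \<subseteq> face_hull P M"
  unfolding face_hull_def using assms by (auto intro!: bexI[of _ 0])

text \<open>
  Each element of the generated face is below some \<open>m \<in> M\<close>, so a downset containing the
  translate \<open>q + M\<close> also contains the translate of the face.
\<close>
lemma localization_face_hull:
  assumes D: "downset P D" and q: "q \<in> localization M D"
  shows "q \<in> localization (face_hull P M) D"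
proof -
  have "q + p \<in> D" if "p \<in> face_hull P M" for p
  proof -
    from that obtain r where r: "r \<in> P" "p + r \<in> M"
      by (auto simp: face_hull_def)
    then have "q + (p + r) \<in> D"
      using q by (auto simp: localization_def)
    moreover have "cone_le P (q + p) (q + (p + r))"
      using r by (simp add: cone_le_def)
    ultimately show ?thesis
      using D unfolding downset_def by blast
  qed
  then show ?thesis
    using q by (auto simp: localization_def)
qed

definition submonoid_sum :: "'a::ab_group_add set \<Rightarrow> 'a set \<Rightarrow> 'a set" where
  "submonoid_sum M N = {m + n | m n. m \<in> M \<and> n \<in> N}"

lemma add_submonoid_submonoid_sum:
  assumes M: "add_submonoid M" and N: "add_submonoid N"
  shows "add_submonoid (submonoid_sum M N)"
proof -
  have "0 + 0 \<in> submonoid_sum M N"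
    using M N unfolding submonoid_sum_def add_submonoid_def by blast
  moreover have "(a + b) + (c + d) \<in> submonoid_sum M N"
    if "a \<in> M" "c \<in> M" "b \<in> N" "d \<in> N" for a b c d
  proof -
    have "(a + c) + (b + d) \<in> submonoid_sum M N"
      using that M N unfolding submonoid_sum_def add_submonoid_def by blast
    then show ?thesis
      by (simp add: ac_simps)
  qed
  ultimately show ?thesis
    by (auto simp: add_submonoid_def submonoid_sum_def)
qed

lemma submonoid_sum_upper:
  assumes "0 \<in> M" and "0 \<in> N"
  shows "M \<subseteq> submonoid_sum M N" and "N \<subseteq> submonoid_sum M N"
  using assms by (force simp: submonoid_sum_def)+

lemma submonoid_sum_least:
  assumes "add_submonoid P" and "M \<subseteq> P" and "N \<subseteq> P"
  shows "submonoid_sum M N \<subseteq> P"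
  using assms by (auto simp: submonoid_sum_def add_submonoid_def)

lemma localization_localization:
  assumes "q \<in> localization N (localization M D)"
  shows "q \<in> localization (submonoid_sum M N) D"
proof -
  have "q + (m + n) \<in> D" if "m \<in> M" "n \<in> N" for m n
  proof -
    have "(q + n) + m \<in> D"
      using assms that by (auto simp: localization_def)
    then show ?thesis
      by (simp add: ac_simps)
  qed
  then show ?thesis
    using assms by (auto simp: localization_def submonoid_sum_def)
qed

text \<open>
  A sum of two positive elements vanishes only if both do, because the cone has trivial unit
  group.
\<close>
lemma face_zero:
  assumes "positive_cone P"
  shows "face P {0}"
proof -
  have P: "add_submonoid P" and units: "\<And>x. x \<in> P \<Longrightarrow> - x \<in> P \<Longrightarrow> x = 0"
    using assms by (auto simp: positive_cone_def)
  have "p + x \<noteq> 0" if "p \<in> P" "x \<in> P" "x \<noteq> 0" for p x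
  proof
    assume "p + x = 0"
    then have "- x = p"
      by (simp add: add_eq_0_iff2)
    then show False
      using units[of x] that by simp
  qed
  then show ?thesis
    using P by (auto simp: face_def monoid_ideal_def add_submonoid_def)
qed

lemma mem_local_support_of_maximal:
  assumes P: "add_submonoid P" and D: "downset P D"
    and \<tau>: "face P \<tau>" "q \<in> localization \<tau> D"
    and max: "\<And>\<sigma>. face P \<sigma> \<Longrightarrow> q \<in> localization \<sigma> D \<Longrightarrow> \<tau> \<subseteq> \<sigma> \<Longrightarrow> \<sigma> = \<tau>"
  shows "q \<in> local_support P \<tau> D"
proof -
  have "\<tau>' \<subseteq> \<tau>" if \<tau>': "face P \<tau>'" and q: "q \<in> localization \<tau>' (localization \<tau> D)" for \<tau>'
  proof -
    let ?S = "submonoid_sum \<tau> \<tau>'"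
    have sub: "add_submonoid \<tau>" "add_submonoid \<tau>'" "\<tau> \<subseteq> P" "\<tau>' \<subseteq> P"
      using \<tau>(1) \<tau>' by (auto simp: face_def)
    have "?S \<subseteq> face_hull P ?S"
      using P sub by (intro subset_face_hull submonoid_sum_least) (auto simp: add_submonoid_def)
    moreover have "\<tau> \<subseteq> ?S" "\<tau>' \<subseteq> ?S"
      using sub by (simp_all add: submonoid_sum_upper add_submonoid_def)
    moreover have "face P (face_hull P ?S)"
      using P sub by (intro face_face_hull add_submonoid_submonoid_sum)
    moreover have "q \<in> localization (face_hull P ?S) D"
      using D q by (intro localization_face_hull localization_localization)
    ultimately show ?thesis
      using max[of "face_hull P ?S"] by blast
  qed
  then show ?thesis
    using \<tau>(2) by (auto simp: local_support_def global_support_def globally_supported_def)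
qed

theorem theorem5p20:
  fixes P D :: "'a::ab_group_add set"
  assumes "polyhedral_pogroup P"
    and "downset P D"
  shows "D = (\<Union>\<tau>\<in>{\<tau>. face P \<tau>}. local_support P \<tau> D)"
proof
  have cone: "positive_cone P" and fin: "finite {\<sigma>. face P \<sigma>}"
    using assms(1) by (auto simp: polyhedral_pogroup_def)
  show "D \<subseteq> (\<Union>\<tau>\<in>{\<tau>. face P \<tau>}. local_support P \<tau> D)"
  proof
    fix q assume "q \<in> D"
    let ?F = "{\<sigma>. face P \<sigma> \<and> q \<in> localization \<sigma> D}"
    have "{0} \<in> ?F"
      using \<open>q \<in> D\<close> face_zero[OF cone] by (simp add: localization_def)
    moreover have "finite ?F"
      using fin by (rule rev_finite_subset) auto
    ultimately obtain \<tau> where \<tau>: "\<tau> \<in> ?F" and max: "\<And>\<sigma>. \<sigma> \<in> ?F \<Longrightarrow> \<tau> \<subseteq> \<sigma> \<Longrightarrow> \<sigma> = \<tau>"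
      using finite_has_maximal2[of ?F "{0}"] by metis
    have "q \<in> local_support P \<tau> D"
      using \<tau> max cone assms(2)
      by (intro mem_local_support_of_maximal) (auto simp: positive_cone_def)
    then show "q \<in> (\<Union>\<tau>\<in>{\<tau>. face P \<tau>}. local_support P \<tau> D)"
      using \<tau> by blast
  qed
  show "(\<Union>\<tau>\<in>{\<tau>. face P \<tau>}. local_support P \<tau> D) \<subseteq> D"
    by (auto simp: local_support_def global_support_def localization_def)
qed

end
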